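(* Let $\varepsilon>0$, $\delta,\beta,\alpha\ge0$, $\lambda>1$ and $n\in\mathbb{N}$, $n\ge1$. Let $M:\mathbb{R}^n\to\mathbb{R}$ be an $(\varepsilon,\delta)$-differentially private (randomized) algorithm such that for every probability distribution $P$ on $\mathbb{R}$ with $\mu(P):=\mathbb{E}_{X\leftarrow P}[X]\in[0,1]$ and $\mathbb{E}_{X\leftarrow P}[|X-\mu(P)|^\lambda]\le1$ we have $$\left|\mathbb{E}_{X\leftarrow P^n,M}[M(X)]-\mu(P)\right|\le\beta\qquad\text{and}\qquad\mathbb{E}_{X\leftarrow P^n,M}\left[(M(X)-\mu(P))^2\right]\le\alpha^2 .$$ If $\beta\le\frac1{80}$ and $\delta\le\left(\dfrac{2\sinh(\varepsilon)}{5^{1+\frac{1}{\lambda-1}}\,(\lambda-1)}\right)^2$, then $$\alpha\ \ge\ \left(32\cdot n\cdot\sinh(\varepsilon)\cdot\frac{\lambda}{\lambda-1}\cdot\max\left\{(16\beta)^{\frac1{\lambda-1}},\ \left(\frac{(\lambda-1)\sqrt{\delta}}{2\sinh(\varepsilon)}\right)^{1/\lambda}\right\}\right)^{-1}.$$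
   Context: A randomized algorithm $M:\mathcal{X}^n\to\mathcal{Y}$ is $(\varepsilon,\delta)$-differentially private, for $\varepsilon,\delta\ge0$, if for all datasets $x,x'\in\mathcal{X}^n$ differing in exactly one coordinate and all measurable $Y\subseteq\mathcal{Y}$, $\Pr[M(x)\in Y]\le e^{\varepsilon}\Pr[M(x')\in Y]+\delta$. $X\leftarrow P^n$ means $X=(X_1,\dots,X_n)$ consists of $n$ i.i.d. samples from $P$; expectations subscripted by $X\leftarrow P^n,M$ are over both $X$ and the independent internal randomness of $M$. If the quantity being inverted is $0$ (i.e. $\beta=\delta=0$), its inverse is read as $+\infty$ (so the conclusion is that no such $M$ exists). *)

theory Defs
  imports "HOL-Probability.Probability"
begin

text \<open>
  As a space, \<open>product_power n A\<close> is the space of datasets of \<open>n\<close> entries from \<open>A\<close> (extensional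
  functions on \<open>{..<n}\<close>); for a probability measure \<open>P\<close>, \<open>product_power n P\<close> is the law \<open>P\<^sup>n\<close> of
  \<open>n\<close> i.i.d. samples.
\<close>

definition product_power :: "nat \<Rightarrow> 'a measure \<Rightarrow> (nat \<Rightarrow> 'a) measure" where
  "product_power n A = (\<Pi>\<^sub>M i\<in>{..<n}. A)"

text \<open>
  A randomized algorithm is a Markov kernel: \<open>M x\<close> is the law of the output on the dataset \<open>x\<close>.
  Measurability in \<open>x\<close> is what makes the joint expectation over a random dataset and the internal
  randomness meaningful.
\<close>

definition randomized_algorithms ::
    "nat \<Rightarrow> 'a measure \<Rightarrow> 'b measure \<Rightarrow> ((nat \<Rightarrow> 'a) \<Rightarrow> 'b measure) set" where
  "randomized_algorithms n A B = product_power n A \<rightarrow>\<^sub>M prob_algebra B"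

definition neighbouring :: "nat \<Rightarrow> (nat \<Rightarrow> 'a) \<Rightarrow> (nat \<Rightarrow> 'a) \<Rightarrow> bool" where
  "neighbouring n x x' \<longleftrightarrow> card {i \<in> {..<n}. x i \<noteq> x' i} = 1"

definition differentially_private ::
    "real \<Rightarrow> real \<Rightarrow> nat \<Rightarrow> 'a measure \<Rightarrow> 'b measure \<Rightarrow> ((nat \<Rightarrow> 'a) \<Rightarrow> 'b measure) \<Rightarrow> bool" where
  "differentially_private \<epsilon> \<delta> n A B M \<longleftrightarrow>
     (\<forall>x \<in> space (product_power n A). \<forall>x' \<in> space (product_power n A). neighbouring n x x' \<longrightarrow>
        (\<forall>Y \<in> sets B. measure (M x) Y \<le> exp \<epsilon> * measure (M x') Y + \<delta>))"

text \<open>The law of \<open>M(X)\<close> for \<open>X\<close> drawn from \<open>P\<^sup>n\<close>, independently of the randomness of \<open>M\<close>.\<close>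

definition output_law :: "nat \<Rightarrow> 'a measure \<Rightarrow> ((nat \<Rightarrow> 'a) \<Rightarrow> 'b measure) \<Rightarrow> 'b measure" where
  "output_law n P M = product_power n P \<bind> M"

definition mean :: "real measure \<Rightarrow> real" where
  "mean P = (\<integral>x. x \<partial>P)"

end

theory Submission imports Defs begin

text \<open>
  The lower bound already holds for data with only two values. Let the samples take the value \<open>v\<close> with
  probability \<open>p\<close> and \<open>0\<close> otherwise, so that their mean is \<open>p * v\<close> and their central moment of order
  \<open>lam\<close> is at most \<open>1\<close> as long as \<open>2 * p * v powr lam \<le> 1\<close>. Write \<open>v = 1 / \<gamma>\<close> and let \<open>p\<close> range over
  \<open>[p1 / 2, p1]\<close> with \<open>p1 = \<gamma> powr lam / 2\<close>. If the bias \<open>\<beta>\<close> is a small fraction of \<open>p1 * v\<close>, that is,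
  if \<open>16 * \<beta> \<le> \<gamma> powr (lam - 1)\<close>, then the mean output as a function of \<open>p\<close> must grow with a slope
  of order \<open>v\<close> at some point of this interval.

  On the other hand the mean output is a polynomial in \<open>p\<close>. Its derivative is a sum over the \<open>n\<close>
  samples of the average change of the output mean when that sample is switched from \<open>0\<close> to \<open>v\<close>
  (\<open>subset_average_has_derivative\<close>). Such a switch leads to a neighbouring dataset, so privacy bounds the
  change (\<open>indistinguishable_mean_diff\<close>): up to constants, by \<open>sinh \<epsilon> * \<alpha>\<close> plus
  \<open>sqrt \<delta> * \<alpha> / sqrt p\<close>. The second term arises by truncating the unbounded output and
  estimating its tail by the second moment, which given the rare value \<open>v\<close> of one sample may be as large
  as \<open>\<alpha>\<^sup>2 / p\<close>. When \<open>(lam - 1) * sqrt \<delta> \<le> 2 * sinh \<epsilon> * \<gamma> powr lam\<close>, it is bounded, up to constants,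
  by \<open>sinh \<epsilon> * \<alpha> / (lam - 1)\<close>, which is the source of the factor \<open>lam / (lam - 1)\<close>.

  Comparing both estimates of the slope gives \<open>1 / \<gamma> \<le> 32 * n * sinh \<epsilon> * lam / (lam - 1) * \<alpha>\<close>
  (\<open>two_point_accuracy_bound\<close>), and the maximum in the theorem is the least \<open>\<gamma>\<close> that meets both
  conditions. The bounds assumed on \<open>\<beta>\<close> and \<open>\<delta>\<close> guarantee \<open>\<gamma> \<le> 1\<close>, and hence \<open>p1 \<le> 1 / 2\<close> and means in \<open>[0, 1]\<close>.
  When this maximum or \<open>\<alpha>\<close> vanishes, the same estimate is applied to slightly larger values.
\<close>

section \<open>Comparing the means of indistinguishable laws\<close>

lemma nn_integral_layer_cake:
  fixes h :: "'a \<Rightarrow> real"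
  assumes "sigma_finite_measure Q" and [measurable]: "h \<in> borel_measurable Q"
    and "\<And>x. x \<in> space Q \<Longrightarrow> 0 \<le> h x"
  shows "(\<integral>\<^sup>+x. ennreal (h x) \<partial>Q) =
    (\<integral>\<^sup>+t. indicator {0..} t * emeasure Q {x \<in> space Q. t < h x} \<partial>lborel)"
proof -
  interpret Q: sigma_finite_measure Q by fact
  interpret pair_sigma_finite Q lborel ..
  have "(\<integral>\<^sup>+x. ennreal (h x) \<partial>Q) = (\<integral>\<^sup>+x. \<integral>\<^sup>+t. indicator {0..} t * indicator {x \<in> space Q. t < h x} x \<partial>lborel \<partial>Q)"
  proof (rule nn_integral_cong)
    fix x assume x: "x \<in> space Q"
    have "(\<integral>\<^sup>+t. indicator {0..} t * indicator {x \<in> space Q. t < h x} x \<partial>lborel) = (\<integral>\<^sup>+t. indicator {0..<h x} t \<partial>lborel)"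
      using x by (intro nn_integral_cong) (auto split: split_indicator)
    then show "ennreal (h x) = (\<integral>\<^sup>+t. indicator {0..} t * indicator {x \<in> space Q. t < h x} x \<partial>lborel)"
      using assms(3)[OF x] by simp
  qed
  also have "\<dots> = (\<integral>\<^sup>+t. \<integral>\<^sup>+x. indicator {0..} t * indicator {x \<in> space Q. t < h x} x \<partial>Q \<partial>lborel)"
    by (intro Fubini'[symmetric]) simp
  also have "\<dots> = (\<integral>\<^sup>+t. indicator {0..} t * emeasure Q {x \<in> space Q. t < h x} \<partial>lborel)"
    by (intro nn_integral_cong) (simp add: nn_integral_cmult)
  finally show ?thesis .
qed

text \<open>
  The privacy guarantee for one ordered pair of output laws, with \<open>K = exp \<epsilon>\<close>. The relation is
  not symmetric, so neighbouring datasets yield it in both directions.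
\<close>

definition indistinguishable :: "real \<Rightarrow> real \<Rightarrow> 'a measure \<Rightarrow> 'a measure \<Rightarrow> bool" where
  "indistinguishable K \<delta> Q R \<longleftrightarrow> (\<forall>Y\<in>sets Q. measure Q Y \<le> K * measure R Y + \<delta>)"

text \<open>
  By the layer cake formula the integral of \<open>h\<close> is the integral over \<open>t\<close> of the probabilities of the
  events \<open>t < h\<close>. Only the levels \<open>t\<close> in \<open>{0..<T}\<close> contribute, and each costs an additive error of
  at most \<open>\<delta>\<close>.
\<close>

lemma indistinguishable_bounded_integral:
  fixes h :: "'a \<Rightarrow> real"
  assumes "prob_space Q" "prob_space R" and [measurable_cong]: "sets Q = sets R"
    and le: "indistinguishable K \<delta> Q R"
    and "K \<ge> 0" "\<delta> \<ge> 0" "T \<ge> 0"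
    and [measurable]: "h \<in> borel_measurable R"
    and h: "\<And>x. 0 \<le> h x" "\<And>x. h x \<le> T"
  shows "(\<integral>x. h x \<partial>Q) \<le> K * (\<integral>x. h x \<partial>R) + \<delta> * T"
proof -
  interpret Q: prob_space Q by fact
  interpret R: prob_space R by fact
  have [measurable]: "h \<in> borel_measurable Q" by measurable
  have sp: "space Q = space R" using assms(3) by (rule sets_eq_imp_space_eq)
  have iQ: "integrable Q h" and iR: "integrable R h"
    using h by (auto intro!: Q.integrable_const_bound[where B=T] R.integrable_const_bound[where B=T])
  have lc: "emeasure Q {x \<in> space Q. t < h x} \<le> ennreal K * emeasure R {x \<in> space R. t < h x} + ennreal \<delta> * indicator {..<T} t" for t
  proof (cases "t < T")
    case True
    have "measure Q {x \<in> space Q. t < h x} \<le> K * measure R {x \<in> space R. t < h x} + \<delta>"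
      using le unfolding indistinguishable_def sp[symmetric] by auto
    then show ?thesis using True \<open>K \<ge> 0\<close> \<open>\<delta> \<ge> 0\<close>
      by (simp add: Q.emeasure_eq_measure R.emeasure_eq_measure flip: ennreal_mult'' ennreal_plus)
  next
    case False
    then have "\<not> t < h x" for x using h(2)[of x] by linarith
    then have "{x \<in> space Q. t < h x} = {}" by simp
    then show ?thesis by (simp only: emeasure_empty) simp
  qed
  have "ennreal (\<integral>x. h x \<partial>Q) = (\<integral>\<^sup>+x. ennreal (h x) \<partial>Q)"
    using iQ h by (simp add: nn_integral_eq_integral)
  also have "\<dots> = (\<integral>\<^sup>+t. indicator {0..} t * emeasure Q {x \<in> space Q. t < h x} \<partial>lborel)"
    by (intro nn_integral_layer_cake Q.sigma_finite_measure_axioms h) auto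
  also have "\<dots> \<le> (\<integral>\<^sup>+t. indicator {0..} t * (ennreal K * emeasure R {x \<in> space R. t < h x} + ennreal \<delta> * indicator {..<T} t) \<partial>lborel)"
    by (intro nn_integral_mono mult_left_mono lc) auto
  also have "\<dots> = (\<integral>\<^sup>+t. ennreal K * (indicator {0..} t * emeasure R {x \<in> space R. t < h x}) + ennreal \<delta> * indicator {0..<T} t \<partial>lborel)"
    by (intro nn_integral_cong) (auto split: split_indicator)
  also have "\<dots> = ennreal K * (\<integral>\<^sup>+t. indicator {0..} t * emeasure R {x \<in> space R. t < h x} \<partial>lborel) + ennreal \<delta> * ennreal T"
    using \<open>T \<ge> 0\<close> by (simp add: nn_integral_add nn_integral_cmult)
  also have "(\<integral>\<^sup>+t. indicator {0..} t * emeasure R {x \<in> space R. t < h x} \<partial>lborel) = (\<integral>\<^sup>+x. ennreal (h x) \<partial>R)"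
    by (intro nn_integral_layer_cake[symmetric] R.sigma_finite_measure_axioms h) auto
  also have "\<dots> = ennreal (\<integral>x. h x \<partial>R)"
    using iR h by (simp add: nn_integral_eq_integral)
  also have "ennreal K * ennreal (\<integral>x. h x \<partial>R) + ennreal \<delta> * ennreal T = ennreal (K * (\<integral>x. h x \<partial>R) + \<delta> * T)"
    using assms(5-7) h by (simp add: ennreal_mult ennreal_plus integral_nonneg_AE)
  finally show ?thesis
    using assms(5-7) h by (subst (asm) ennreal_le_iff) (auto intro!: add_nonneg_nonneg mult_nonneg_nonneg integral_nonneg_AE)
qed

text \<open>
  Truncation at a level \<open>T\<close> extends the comparison to unbounded functions: the additive error is
  \<open>\<delta> * T\<close> on the truncated part, and the excess over \<open>T\<close> is controlled by the second moment, because
  \<open>x - T \<le> x\<^sup>2 / (4 * T)\<close>. The optimal \<open>T\<close> depends on the second moment; keeping it free makes the bound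
  affine in the second moment, so that it can be averaged over many pairs of laws before \<open>T\<close> is chosen.
\<close>

lemma indistinguishable_square_integrable:
  fixes N :: "'a \<Rightarrow> real"
  assumes "prob_space Q" "prob_space R" and sets[measurable_cong]: "sets Q = sets R"
    and le: "indistinguishable K \<delta> Q R"
    and "K \<ge> 0" "\<delta> \<ge> 0" "T > 0"
    and [measurable]: "N \<in> borel_measurable R"
    and N: "\<And>x. 0 \<le> N x"
    and iQ: "integrable Q N" "integrable Q (\<lambda>x. (N x)\<^sup>2)" and iR: "integrable R N"
  shows "(\<integral>x. N x \<partial>Q) \<le> K * (\<integral>x. N x \<partial>R) + \<delta> * T + (\<integral>x. (N x)\<^sup>2 \<partial>Q) / (4 * T)"
proof -
  have [measurable]: "N \<in> borel_measurable Q" by measurable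
  have mQ: "integrable Q (\<lambda>x. min (N x) T)"
    by (rule Bochner_Integration.integrable_bound[OF iQ(1)]) (use N \<open>T > 0\<close> in auto)
  have mR: "integrable R (\<lambda>x. min (N x) T)"
    by (rule Bochner_Integration.integrable_bound[OF iR]) (use N \<open>T > 0\<close> in auto)
  have pt: "N x \<le> min (N x) T + (N x)\<^sup>2 / (4 * T)" for x
  proof (cases "N x \<le> T")
    case False
    have "0 \<le> (N x - 2 * T)\<^sup>2" by simp
    then show ?thesis using False \<open>T > 0\<close> by (simp add: field_simps power2_eq_square)
  qed (use \<open>T > 0\<close> in auto)
  have "(\<integral>x. N x \<partial>Q) \<le> (\<integral>x. min (N x) T + (N x)\<^sup>2 / (4 * T) \<partial>Q)"
    by (intro integral_mono iQ Bochner_Integration.integrable_add mQ integrable_divide pt) 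
  also have "\<dots> = (\<integral>x. min (N x) T \<partial>Q) + (\<integral>x. (N x)\<^sup>2 \<partial>Q) / (4 * T)"
    using mQ iQ by simp
  also have "(\<integral>x. min (N x) T \<partial>Q) \<le> K * (\<integral>x. min (N x) T \<partial>R) + \<delta> * T"
    by (rule indistinguishable_bounded_integral) (use assms in auto)
  also have "(\<integral>x. min (N x) T \<partial>R) \<le> (\<integral>x. N x \<partial>R)"
    by (intro integral_mono mR iR) auto
  finally show ?thesis using \<open>K \<ge> 0\<close> by (simp add: mult_left_mono)
qed

text \<open>
  The positive part of \<open>y - c\<close> is compared from \<open>Q\<close> to \<open>R\<close> and the negative part from \<open>R\<close> to
  \<open>Q\<close>. In this way the multiplicative loss \<open>K - 1\<close> is only ever charged to first moments under \<open>R\<close>. This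
  asymmetry matters: below, \<open>R\<close> is a likely outcome and \<open>Q\<close> a rare one, so that only the second moment under
  \<open>R\<close> is well controlled. The second moment under \<open>Q\<close> enters with the factor \<open>1 / (4 * T)\<close> alone.
\<close>

lemma indistinguishable_mean_diff:
  fixes Q R :: "real measure"
  assumes "prob_space Q" "prob_space R" and setsQ: "sets Q = sets borel" and setsR: "sets R = sets borel"
    and QR: "indistinguishable K \<delta> Q R" and RQ: "indistinguishable K \<delta> R Q"
    and "K \<ge> 1" "\<delta> \<ge> 0" "T > 0" "a > 0"
    and sq: "integrable Q (\<lambda>y. (y - c)\<^sup>2)" "integrable R (\<lambda>y. (y - c)\<^sup>2)"
  shows "(\<integral>y. y \<partial>Q) - (\<integral>y. y \<partial>R) \<le>
    (K - 1) * ((\<integral>y. (y - c)\<^sup>2 \<partial>R) / (2 * a) + a / 2) +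
    2 * \<delta> * T + ((\<integral>y. (y - c)\<^sup>2 \<partial>Q) + (\<integral>y. (y - c)\<^sup>2 \<partial>R)) / (4 * T)"
proof -
  interpret Q: prob_space Q by fact
  interpret R: prob_space R by fact
  note [measurable_cong] = setsQ setsR
  have iQ: "integrable Q (\<lambda>y. y - c)" by (rule Q.square_integrable_imp_integrable) (use sq in auto)
  have iR: "integrable R (\<lambda>y. y - c)" by (rule R.square_integrable_imp_integrable) (use sq in auto)
  have iQ': "integrable Q (\<lambda>y. y)" using Bochner_Integration.integrable_add[OF iQ, of "\<lambda>_. c"] by simp
  have iR': "integrable R (\<lambda>y. y)" using Bochner_Integration.integrable_add[OF iR, of "\<lambda>_. c"] by simp
  define P where "P = (\<lambda>y. max (y - c) 0)"
  define N where "N = (\<lambda>y. max (c - y) 0)"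
  have [measurable]: "P \<in> borel_measurable borel" "N \<in> borel_measurable borel"
    unfolding P_def N_def by auto
  have dec: "y - c = P y - N y" "\<bar>y - c\<bar> = P y + N y" "0 \<le> P y" "0 \<le> N y" 
    "(P y)\<^sup>2 \<le> (y - c)\<^sup>2" "(N y)\<^sup>2 \<le> (y - c)\<^sup>2" for y
    by (auto simp: P_def N_def max_def power2_commute)
  have int: "integrable Q P" "integrable Q N" "integrable R P" "integrable R N"
    using dec by (auto intro!: Bochner_Integration.integrable_bound[OF iQ] Bochner_Integration.integrable_bound[OF iR])
  have int2: "integrable Q (\<lambda>y. (P y)\<^sup>2)" "integrable R (\<lambda>y. (N y)\<^sup>2)"
    using dec by (auto intro!: Bochner_Integration.integrable_bound[OF sq(1)] Bochner_Integration.integrable_bound[OF sq(2)])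
  have pos: "(\<integral>y. P y \<partial>Q) \<le> K * (\<integral>y. P y \<partial>R) + \<delta> * T + (\<integral>y. (P y)\<^sup>2 \<partial>Q) / (4 * T)"
    by (rule indistinguishable_square_integrable) (use assms int int2 dec in auto)
  have neg: "(\<integral>y. N y \<partial>R) \<le> K * (\<integral>y. N y \<partial>Q) + \<delta> * T + (\<integral>y. (N y)\<^sup>2 \<partial>R) / (4 * T)"
    by (rule indistinguishable_square_integrable) (use assms int int2 dec in auto)
  have P2: "(\<integral>y. (P y)\<^sup>2 \<partial>Q) \<le> (\<integral>y. (y - c)\<^sup>2 \<partial>Q)"
    by (intro integral_mono int2 sq dec)
  have N2: "(\<integral>y. (N y)\<^sup>2 \<partial>R) \<le> (\<integral>y. (y - c)\<^sup>2 \<partial>R)"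
    by (intro integral_mono int2 sq dec)
  define V where "V = (\<integral>y. (y - c)\<^sup>2 \<partial>Q) + (\<integral>y. (y - c)\<^sup>2 \<partial>R)"
  have V: "(\<integral>y. (P y)\<^sup>2 \<partial>Q) / (4 * T) + (\<integral>y. (N y)\<^sup>2 \<partial>R) / (4 * T) \<le> V / (4 * T)"
    unfolding V_def add_divide_distrib[symmetric] using P2 N2 \<open>T > 0\<close> by (intro divide_right_mono) auto
  have abs: "(\<integral>y. P y \<partial>R) + (\<integral>y. N y \<partial>R) \<le> (\<integral>y. (y - c)\<^sup>2 \<partial>R) / (2 * a) + a / 2"
  proof -
    have pt: "P y + N y \<le> (y - c)\<^sup>2 / (2 * a) + a / 2" for y
    proof -
      \<comment> \<open>An affine bound on \<open>\<bar>y - c\<bar>\<close> by the square, in place of the Cauchy-Schwarz inequality.\<close>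
      have "0 \<le> (\<bar>y - c\<bar> - a)\<^sup>2" by simp
      then have "2 * a * \<bar>y - c\<bar> \<le> (y - c)\<^sup>2 + a\<^sup>2" by (simp add: power2_diff algebra_simps)
      then show ?thesis using \<open>a > 0\<close> unfolding dec(2)[symmetric]
        by (simp add: field_simps power2_eq_square)
    qed
    have "(\<integral>y. P y + N y \<partial>R) \<le> (\<integral>y. (y - c)\<^sup>2 / (2 * a) + a / 2 \<partial>R)"
      by (intro integral_mono Bochner_Integration.integrable_add int integrable_divide sq pt) auto
    then show ?thesis using int sq by (simp add: R.prob_space)
  qed
  have N0: "(\<integral>y. N y \<partial>Q) \<ge> 0" "(\<integral>y. P y \<partial>R) \<ge> 0" "(\<integral>y. N y \<partial>R) \<ge> 0" using dec by (auto intro!: integral_nonneg_AE)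
  define nR nQ where "nR = (\<integral>y. N y \<partial>R)" and "nQ = (\<integral>y. N y \<partial>Q)"
  define r where "r = \<delta> * T + (\<integral>y. (N y)\<^sup>2 \<partial>R) / (4 * T)"
  have r0: "r \<ge> 0" unfolding r_def using \<open>\<delta> \<ge> 0\<close> \<open>T > 0\<close> by (auto intro!: add_nonneg_nonneg divide_nonneg_nonneg integral_nonneg_AE)
  \<comment> \<open>The bound \<open>neg\<close> has the factor \<open>K\<close> at the wrong law, which is harmless when \<open>nQ \<le> nR\<close>;
    otherwise the left-hand side is negative.\<close>
  have "nR - nQ \<le> (K - 1) * nR + r"
  proof (cases "nQ \<le> nR")
    case True
    have "(K - 1) * nQ \<le> (K - 1) * nR" using True \<open>K \<ge> 1\<close> by (intro mult_left_mono) auto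
    then show ?thesis using neg unfolding nR_def[symmetric] nQ_def[symmetric] r_def[symmetric] add.assoc
      by (simp add: algebra_simps r_def)
  next
    case False
    have "0 \<le> (K - 1) * nR" using \<open>K \<ge> 1\<close> N0 unfolding nR_def by simp
    then show ?thesis using False r0 by simp
  qed
  moreover have "(\<integral>y. y \<partial>Q) - (\<integral>y. y \<partial>R) = (\<integral>y. y - c \<partial>Q) - (\<integral>y. y - c \<partial>R)"
    using iQ' iR' by (simp add: Q.prob_space R.prob_space)
  moreover have "\<dots> = (\<integral>y. P y \<partial>Q) - nQ - ((\<integral>y. P y \<partial>R) - nR)"
    unfolding dec(1) nQ_def nR_def using int by simp
  moreover have "(K - 1) * ((\<integral>y. P y \<partial>R) + nR) \<le> (K - 1) * ((\<integral>y. (y - c)\<^sup>2 \<partial>R) / (2 * a) + a / 2)"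
    using abs \<open>K \<ge> 1\<close> unfolding nR_def by (intro mult_left_mono) auto
  ultimately show ?thesis using pos V unfolding r_def V_def[symmetric] by (simp add: algebra_simps)
qed

section \<open>Averages over random subsets\<close>

definition subset_weight :: "real \<Rightarrow> 'i set \<Rightarrow> 'i set \<Rightarrow> real" where
  "subset_weight p I S = (\<Prod>i\<in>I. if i \<in> S then p else 1 - p)"

text \<open>
  The expectation of \<open>f S\<close> for a random subset \<open>S\<close> of \<open>I\<close> that contains each index independently with
  probability \<open>p\<close>.
\<close>

definition subset_average :: "real \<Rightarrow> 'i set \<Rightarrow> ('i set \<Rightarrow> real) \<Rightarrow> real" where
  "subset_average p I f = (\<Sum>S\<in>Pow I. subset_weight p I S * f S)"

lemma subset_weight_insert:
  assumes "finite I" "i \<notin> I" "S \<subseteq> I"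
  shows "subset_weight p (insert i I) S = (1 - p) * subset_weight p I S"
    and "subset_weight p (insert i I) (insert i S) = p * subset_weight p I S"
proof -
  show "subset_weight p (insert i I) S = (1 - p) * subset_weight p I S"
    unfolding subset_weight_def using assms by (subst prod.insert) auto
  have "(\<Prod>j\<in>I. if j \<in> insert i S then p else 1 - p) = (\<Prod>j\<in>I. if j \<in> S then p else 1 - p)"
    using assms by (intro prod.cong) auto
  then show "subset_weight p (insert i I) (insert i S) = p * subset_weight p I S"
    unfolding subset_weight_def using assms by (subst prod.insert) auto
qed

lemma subset_weight_pos: "0 < p \<Longrightarrow> p < 1 \<Longrightarrow> 0 < subset_weight p I S"
  unfolding subset_weight_def by (intro prod_pos) auto

lemma sum_Pow_insert:
  assumes "finite I" "i \<notin> I"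
  shows "(\<Sum>S\<in>Pow (insert i I). f S) = (\<Sum>S\<in>Pow I. f S) + (\<Sum>S\<in>Pow I. f (insert i S))"
proof -
  have "inj_on (insert i) (Pow I)" using assms by (intro inj_onI) (metis PowD insert_ident subsetD)
  then show ?thesis
    unfolding Pow_insert using assms
    by (subst sum.union_disjoint) (auto simp: sum.reindex)
qed

lemma subset_average_insert:
  assumes "finite I" "i \<notin> I"
  shows "subset_average p (insert i I) f =
    (1 - p) * subset_average p I f + p * subset_average p I (\<lambda>S. f (insert i S))"
  unfolding subset_average_def sum_Pow_insert[OF assms] sum_distrib_left
  using assms by (intro arg_cong2[where f="(+)"] sum.cong) (auto simp: subset_weight_insert)

lemma subset_average_linear:
  "subset_average p I (\<lambda>S. f S + g S) = subset_average p I f + subset_average p I g"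
  "subset_average p I (\<lambda>S. f S - g S) = subset_average p I f - subset_average p I g"
  "subset_average p I (\<lambda>S. c * f S) = c * subset_average p I f"
  "subset_average p I (\<lambda>S. f S / c) = subset_average p I f / c"
  unfolding subset_average_def
  by (simp_all add: sum.distrib sum_subtractf sum_distrib_left sum_divide_distrib algebra_simps)

lemma subset_average_const: "finite I \<Longrightarrow> subset_average p I (\<lambda>S. c) = c"
proof (induction I rule: finite_induct)
  case empty
  show ?case by (simp add: subset_average_def subset_weight_def)
next
  case (insert i I)
  then show ?case by (simp add: subset_average_insert algebra_simps)
qed

lemma subset_average_mono:
  assumes "0 < p" "p < 1" "\<And>S. S \<subseteq> I \<Longrightarrow> f S \<le> g S"
  shows "subset_average p I f \<le> subset_average p I g"
  unfolding subset_average_def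
  using assms subset_weight_pos[of p I] by (intro sum_mono mult_left_mono) (auto simp: less_imp_le)

text \<open>
  The Margulis--Russo formula. By the recursion \<open>subset_average_insert\<close>, an index \<open>i\<close> contributes to
  the derivative in \<open>p\<close> the average effect of adding \<open>i\<close> to the random set, and the other contributions
  are averaged over whether \<open>i\<close> is present.
\<close>

lemma subset_average_has_derivative:
  assumes "finite I"
  shows "((\<lambda>p. subset_average p I f) has_real_derivative
    (\<Sum>i\<in>I. subset_average p (I - {i}) (\<lambda>S. f (insert i S) - f S))) (at p)"
  using assms
proof (induction I arbitrary: f rule: finite_induct)
  case empty
  show ?case by (simp add: subset_average_def subset_weight_def)
next
  case (insert i I)
  let ?g = "\<lambda>S. f (insert i S)"
  let ?D = "\<lambda>f. \<Sum>j\<in>I. subset_average p (I - {j}) (\<lambda>S. f (insert j S) - f S)"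
  have der: "((\<lambda>p. subset_average p (insert i I) f) has_real_derivative
      (- subset_average p I f + (1 - p) * ?D f) + (subset_average p I ?g + p * ?D ?g)) (at p)"
    unfolding subset_average_insert[OF insert.hyps]
    by (rule derivative_eq_intros refl insert.IH)+ simp
  have split: "subset_average p (insert i I - {j}) (\<lambda>S. f (insert j S) - f S) =
      (1 - p) * subset_average p (I - {j}) (\<lambda>S. f (insert j S) - f S) +
      p * subset_average p (I - {j}) (\<lambda>S. ?g (insert j S) - ?g S)" if "j \<in> I" for j
  proof -
    have "insert i I - {j} = insert i (I - {j})" using that insert.hyps by auto
    then show ?thesis using insert.hyps by (simp add: subset_average_insert insert_commute)
  qed
  have "(\<Sum>j\<in>insert i I. subset_average p (insert i I - {j}) (\<lambda>S. f (insert j S) - f S)) =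
      subset_average p I (\<lambda>S. ?g S - f S) + ((1 - p) * ?D f + p * ?D ?g)"
    using insert.hyps by (simp add: split sum.distrib sum_distrib_left)
  also have "\<dots> = (- subset_average p I f + (1 - p) * ?D f) + (subset_average p I ?g + p * ?D ?g)"
    by (simp add: subset_average_linear)
  finally show ?case using der by simp
qed

section \<open>Independent samples from a two-point distribution\<close>

definition two_point :: "real \<Rightarrow> real \<Rightarrow> real measure" where
  "two_point p v = distr (measure_pmf (bernoulli_pmf p)) borel (\<lambda>b. if b then v else 0)"

lemma sets_two_point [measurable_cong, simp]: "sets (two_point p v) = sets borel"
  by (simp add: two_point_def)

lemma prob_space_two_point: "prob_space (two_point p v)"
  unfolding two_point_def by (intro measure_pmf.prob_space_distr) simp

lemma real_distribution_two_point: "real_distribution (two_point p v)"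
  unfolding real_distribution_def real_distribution_axioms_def
  using prob_space_two_point[of p v] by (simp add: two_point_def)

lemma nn_integral_two_point:
  assumes "0 \<le> p" "p \<le> 1" and [measurable]: "f \<in> borel_measurable borel"
  shows "(\<integral>\<^sup>+x. f x \<partial>two_point p v) = ennreal (1 - p) * f 0 + ennreal p * f v"
  using assms unfolding two_point_def
  by (subst nn_integral_distr) (simp_all add: ac_simps)

lemma integrable_two_point: "integrable (two_point p v) (\<lambda>x. x)"
  unfolding two_point_def by (subst integrable_distr_eq) (auto intro: integrable_measure_pmf_finite)

lemma mean_two_point: "0 \<le> p \<Longrightarrow> p \<le> 1 \<Longrightarrow> mean (two_point p v) = p * v"
  unfolding mean_def two_point_def by (subst integral_distr) auto

text \<open>
  Each of the two atoms contributes at most \<open>p * v powr lam\<close>: the atom \<open>v\<close> because its distance to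
  the mean is at most \<open>v\<close>, the atom \<open>0\<close> because \<open>p powr lam \<le> p\<close>.
\<close>

lemma two_point_central_moment:
  assumes p: "0 \<le> p" "p \<le> 1 / 2" and "lam \<ge> 1" "v \<ge> 0" and pv: "2 * p * v powr lam \<le> 1"
  shows "(\<integral>\<^sup>+x. ennreal (\<bar>x - mean (two_point p v)\<bar> powr lam) \<partial>two_point p v) \<le> 1"
proof -
  have "(\<integral>\<^sup>+x. ennreal (\<bar>x - mean (two_point p v)\<bar> powr lam) \<partial>two_point p v) =
      ennreal ((1 - p) * (p * v) powr lam + p * (v * (1 - p)) powr lam)"
  proof -
    have "v - p * v = v * (1 - p)" by (simp add: algebra_simps)
    then have "\<bar>v - p * v\<bar> = v * (1 - p)" using assms by simp
    moreover have "\<bar>0 - p * v\<bar> = p * v" using assms by simp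
    ultimately show ?thesis
      using assms by (simp add: nn_integral_two_point mean_two_point ennreal_mult)
  qed
  also have "\<dots> \<le> ennreal 1"
  proof (rule ennreal_leI)
    have "p powr lam \<le> p"
      using powr_mono'[of 1 lam p] assms by simp
    then have "(1 - p) * (p * v) powr lam \<le> 1 * (p * v powr lam)"
      using assms by (intro mult_mono) (auto simp: powr_mult mult_right_mono)
    moreover have "p * (v * (1 - p)) powr lam \<le> p * v powr lam"
      using assms by (intro mult_left_mono powr_mono2) (auto simp: mult_left_le)
    ultimately show "(1 - p) * (p * v) powr lam + p * (v * (1 - p)) powr lam \<le> 1"
      using pv by simp
  qed
  finally show ?thesis by simp
qed

text \<open>
  A dataset with entries in \<open>{0, v}\<close> is encoded by the set of positions of \<open>v\<close>; restricting the
  function to \<open>I\<close> makes it a point of the product space.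
\<close>

definition two_point_dataset :: "'i set \<Rightarrow> real \<Rightarrow> 'i set \<Rightarrow> 'i \<Rightarrow> real" where
  "two_point_dataset I v S = (\<lambda>i\<in>I. if i \<in> S then v else 0)"

lemma two_point_dataset_in_space [simp]:
  "two_point_dataset I v S \<in> space (Pi\<^sub>M I (\<lambda>_. borel))"
  by (simp add: two_point_dataset_def space_PiM)

lemma nn_integral_PiM_two_point:
  assumes "finite I" and p: "0 < p" "p < 1" and "f \<in> borel_measurable (Pi\<^sub>M I (\<lambda>_. borel))"
  shows "(\<integral>\<^sup>+x. f x \<partial>Pi\<^sub>M I (\<lambda>_. two_point p v)) =
    (\<Sum>S\<in>Pow I. ennreal (subset_weight p I S) * f (two_point_dataset I v S))"
  using assms(1,4)
proof (induction I arbitrary: f rule: finite_induct)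
  case empty
  interpret product_sigma_finite "\<lambda>_. two_point p v"
    by (intro product_sigma_finite.intro prob_space_imp_sigma_finite prob_space_two_point)
  show ?case by (simp add: subset_weight_def two_point_dataset_def PiM_empty nn_integral_count_space_finite restrict_def)
next
  case (insert i I)
  interpret product_sigma_finite "\<lambda>_. two_point p v"
    by (intro product_sigma_finite.intro prob_space_imp_sigma_finite prob_space_two_point)
  note [measurable] = insert.prems
  have cong: "sets (Pi\<^sub>M J (\<lambda>_. two_point p v)) = sets (Pi\<^sub>M J (\<lambda>_. borel :: real measure))" for J :: "'a set"
    by (intro sets_PiM_cong) auto
  have upd: "(two_point_dataset I v S)(i := 0) = two_point_dataset (insert i I) v S"
      "(two_point_dataset I v S)(i := v) = two_point_dataset (insert i I) v (insert i S)" if "S \<subseteq> I" for S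
    using insert.hyps that by (auto simp: two_point_dataset_def fun_eq_iff)
  have m[measurable]: "(\<lambda>x. f (x(i := y))) \<in> borel_measurable (Pi\<^sub>M I (\<lambda>_. borel))" for y by measurable
  have "(\<integral>\<^sup>+x. f x \<partial>Pi\<^sub>M (insert i I) (\<lambda>_. two_point p v)) =
      (\<integral>\<^sup>+x. \<integral>\<^sup>+y. f (x(i := y)) \<partial>two_point p v \<partial>Pi\<^sub>M I (\<lambda>_. two_point p v))"
    using insert by (intro product_nn_integral_insert) (auto simp: measurable_cong_sets[OF cong refl])
  also have "\<dots> = (\<integral>\<^sup>+x. ennreal (1 - p) * f (x(i := 0)) + ennreal p * f (x(i := v)) \<partial>Pi\<^sub>M I (\<lambda>_. two_point p v))"
  proof (rule nn_integral_cong)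
    fix x assume "x \<in> space (Pi\<^sub>M I (\<lambda>_. two_point p v))"
    then have [measurable]: "x \<in> space (Pi\<^sub>M I (\<lambda>_. borel))" using cong[of I] by (metis sets_eq_imp_space_eq)
    have "(\<lambda>y. f (x(i := y))) \<in> borel_measurable borel" by measurable
    then show "(\<integral>\<^sup>+y. f (x(i := y)) \<partial>two_point p v) = ennreal (1 - p) * f (x(i := 0)) + ennreal p * f (x(i := v))"
      using p by (intro nn_integral_two_point) auto
  qed
  also have "\<dots> = (\<Sum>S\<in>Pow I. ennreal (subset_weight p I S) *
      (ennreal (1 - p) * f ((two_point_dataset I v S)(i := 0)) + ennreal p * f ((two_point_dataset I v S)(i := v))))"
    by (intro insert.IH) measurable
  also have "\<dots> = (\<Sum>S\<in>Pow (insert i I). ennreal (subset_weight p (insert i I) S) * f (two_point_dataset (insert i I) v S))"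
    unfolding sum_Pow_insert[OF insert.hyps] sum.distrib[symmetric]
    using insert.hyps p
    by (intro sum.cong refl) (auto simp: upd subset_weight_insert ennreal_mult subset_weight_pos less_imp_le
      distrib_left ac_simps)
  finally show ?case .
qed

text \<open>
  Measures that are mixtures are known here only through their integrals of non-negative functions; the
  integral of a signed function follows by splitting it into positive and negative part.
\<close>

lemma integral_subset_average:
  fixes f :: "'b \<Rightarrow> real"
  assumes "0 < p" "p < 1" "finite I" and f: "integrable Q f" 
    and fS: "\<And>S. S \<subseteq> I \<Longrightarrow> integrable (R S) f"
    and nn: "\<And>h. h \<in> borel_measurable Q \<Longrightarrow>
      (\<integral>\<^sup>+y. h y \<partial>Q) = (\<Sum>S\<in>Pow I. ennreal (subset_weight p I S) * (\<integral>\<^sup>+y. h y \<partial>R S))"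
  shows "(\<integral>y. f y \<partial>Q) = subset_average p I (\<lambda>S. \<integral>y. f y \<partial>R S)"
proof -
  have w: "0 \<le> subset_weight p I S" for S by (rule less_imp_le[OF subset_weight_pos[OF assms(1,2)]])
  have nonneg: "(\<integral>y. g y \<partial>Q) = subset_average p I (\<lambda>S. \<integral>y. g y \<partial>R S)"
    if g: "integrable Q g" "\<And>S. S \<subseteq> I \<Longrightarrow> integrable (R S) g" "\<And>y. 0 \<le> g y" for g :: "'b \<Rightarrow> real"
  proof -
    have "ennreal (\<integral>y. g y \<partial>Q) = (\<integral>\<^sup>+y. ennreal (g y) \<partial>Q)"
      using g by (simp add: nn_integral_eq_integral)
    also have "\<dots> = (\<Sum>S\<in>Pow I. ennreal (subset_weight p I S) * (\<integral>\<^sup>+y. ennreal (g y) \<partial>R S))"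
      using g by (intro nn) auto
    also have "\<dots> = (\<Sum>S\<in>Pow I. ennreal (subset_weight p I S * (\<integral>y. g y \<partial>R S)))"
      using g w by (intro sum.cong refl) (simp add: nn_integral_eq_integral ennreal_mult integral_nonneg_AE)
    also have "\<dots> = ennreal (subset_average p I (\<lambda>S. \<integral>y. g y \<partial>R S))"
      unfolding subset_average_def using g w by (intro sum_ennreal) (simp add: integral_nonneg_AE)
    finally show ?thesis
      using g w by (subst (asm) ennreal_inj)
        (auto simp: subset_average_def integral_nonneg_AE intro!: sum_nonneg mult_nonneg_nonneg)
  qed
  have decomp: "(\<integral>y. f y \<partial>M) = (\<integral>y. max (f y) 0 \<partial>M) - (\<integral>y. max (- f y) 0 \<partial>M)" if "integrable M f" for M
  proof -
    have "(\<integral>y. max (f y) 0 - max (- f y) 0 \<partial>M) = (\<integral>y. max (f y) 0 \<partial>M) - (\<integral>y. max (- f y) 0 \<partial>M)"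
      using that by (intro Bochner_Integration.integral_diff) auto
    moreover have "(\<lambda>y. max (f y) 0 - max (- f y) 0) = f" by (auto simp: max_def)
    ultimately show ?thesis by simp
  qed
  have "subset_average p I (\<lambda>S. \<integral>y. f y \<partial>R S) =
      subset_average p I (\<lambda>S. (\<integral>y. max (f y) 0 \<partial>R S) - (\<integral>y. max (- f y) 0 \<partial>R S))"
    unfolding subset_average_def by (intro sum.cong) (auto simp: decomp[OF fS])
  then show ?thesis
    using f fS by (subst decomp[OF f]) (auto simp: subset_average_linear nonneg)
qed

lemma sets_output_law:
  assumes M: "M \<in> randomized_algorithms n A B" and P: "sets P = sets A" "space P \<noteq> {}"
  shows "sets (output_law n P M) = sets B"
proof -
  have sets: "sets (product_power n P) = sets (product_power n A)"
    unfolding product_power_def using P by (intro sets_PiM_cong) auto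
  have "sets (M x) = sets B" if "x \<in> space (product_power n P)" for x
  proof -
    have "M x \<in> space (prob_algebra B)"
      using M that sets_eq_imp_space_eq[OF sets] unfolding randomized_algorithms_def
      by (auto intro: measurable_space)
    then show ?thesis by (simp add: space_prob_algebra)
  qed
  moreover have "space (product_power n P) \<noteq> {}"
    using P(2) by (auto simp: product_power_def space_PiM PiE_eq_empty_iff)
  ultimately show ?thesis
    unfolding output_law_def by (intro sets_bind) auto
qed

lemma nn_integral_output_law_two_point:
  assumes M: "M \<in> randomized_algorithms n borel B" and p: "0 < p" "p < 1"
    and h: "h \<in> borel_measurable B"
  shows "(\<integral>\<^sup>+y. h y \<partial>output_law n (two_point p v) M) =
    (\<Sum>S\<in>Pow {..<n}. ennreal (subset_weight p {..<n} S) * (\<integral>\<^sup>+y. h y \<partial>M (two_point_dataset {..<n} v S)))"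
proof -
  have Mm: "M \<in> Pi\<^sub>M {..<n} (\<lambda>_. borel) \<rightarrow>\<^sub>M subprob_algebra B"
    using M unfolding randomized_algorithms_def product_power_def by (rule measurable_prob_algebraD)
  have sets: "sets (Pi\<^sub>M {..<n} (\<lambda>_. two_point p v)) = sets (Pi\<^sub>M {..<n} (\<lambda>_. borel :: real measure))"
    by (intro sets_PiM_cong) auto
  have "(\<integral>\<^sup>+y. h y \<partial>output_law n (two_point p v) M) =
      (\<integral>\<^sup>+x. \<integral>\<^sup>+y. h y \<partial>M x \<partial>Pi\<^sub>M {..<n} (\<lambda>_. two_point p v))"
    unfolding output_law_def product_power_def
    by (rule nn_integral_bind[OF h]) (use Mm in \<open>simp add: measurable_cong_sets[OF sets refl]\<close>)
  also have "\<dots> = (\<Sum>S\<in>Pow {..<n}. ennreal (subset_weight p {..<n} S) *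
      (\<integral>\<^sup>+y. h y \<partial>M (two_point_dataset {..<n} v S)))"
    using p by (intro nn_integral_PiM_two_point)
      (auto intro!: measurable_compose[OF Mm] nn_integral_measurable_subprob_algebra h)
  finally show ?thesis .
qed

section \<open>Privacy limits the derivative of the mean output\<close>

text \<open>
  The right-hand side of the Margulis--Russo formula is small if the output laws of adjacent sets are
  indistinguishable. For each index \<open>i\<close>, let \<open>V0\<close> and \<open>V1\<close> be the average second moments without and with
  \<open>i\<close>. Only the mixture \<open>(1 - p) * V0 + p * V1\<close> is bounded by \<open>a\<^sup>2\<close>, whence \<open>V0 \<le> 2 * a\<^sup>2\<close>, but merely
  \<open>V0 + V1 \<le> a\<^sup>2 / p\<close>. The bound of \<open>indistinguishable_mean_diff\<close> is affine in the second moments, so it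
  passes to averages.
\<close>

lemma indistinguishable_influence_bound:
  fixes R :: "'i set \<Rightarrow> real measure"
  assumes "finite I"
    and prob: "\<And>S. S \<subseteq> I \<Longrightarrow> prob_space (R S)" "\<And>S. S \<subseteq> I \<Longrightarrow> sets (R S) = sets borel"
    and dp: "\<And>i S. i \<in> I \<Longrightarrow> S \<subseteq> I - {i} \<Longrightarrow> indistinguishable K \<delta> (R (insert i S)) (R S)"
      "\<And>i S. i \<in> I \<Longrightarrow> S \<subseteq> I - {i} \<Longrightarrow> indistinguishable K \<delta> (R S) (R (insert i S))"
    and "K \<ge> 1" "\<delta> \<ge> 0" "T > 0" "a > 0" and p: "0 < p" "p \<le> 1 / 2"
    and sq: "\<And>S. S \<subseteq> I \<Longrightarrow> integrable (R S) (\<lambda>y. (y - c)\<^sup>2)"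
    and avg: "subset_average p I (\<lambda>S. \<integral>y. (y - c)\<^sup>2 \<partial>R S) \<le> a\<^sup>2"
  shows "(\<Sum>i\<in>I. subset_average p (I - {i}) (\<lambda>S. (\<integral>y. y \<partial>R (insert i S)) - (\<integral>y. y \<partial>R S))) \<le>
    real (card I) * ((K - 1) * (3 / 2 * a) + 2 * \<delta> * T + a\<^sup>2 / (4 * T * p))"
proof (rule sum_bounded_above)
  fix i assume i: "i \<in> I"
  define V where "V = (\<lambda>S. \<integral>y. (y - c)\<^sup>2 \<partial>R S)"
  define V0 where "V0 = subset_average p (I - {i}) V"
  define V1 where "V1 = subset_average p (I - {i}) (\<lambda>S. V (insert i S))"
  have fin: "finite (I - {i})" and ins: "insert i (I - {i}) = I" using \<open>finite I\<close> i by auto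
  have V_avg: "(1 - p) * V0 + p * V1 \<le> a\<^sup>2"
    using avg subset_average_insert[OF fin, of i p V] unfolding ins V_def[symmetric] V0_def V1_def by simp
  have "V S \<ge> 0" for S unfolding V_def by (auto intro!: integral_nonneg_AE)
  then have nn: "V0 \<ge> 0" "V1 \<ge> 0"
    unfolding V0_def V1_def subset_average_def
    using less_imp_le[OF subset_weight_pos[of p "I - {i}"]] p by (auto intro!: sum_nonneg)
  have "1 / 2 * V0 \<le> (1 - p) * V0" using p nn by (intro mult_right_mono) auto
  moreover have "p * V0 \<le> (1 - p) * V0" using p nn by (intro mult_right_mono) auto
  moreover have "0 \<le> p * V1" using p nn by simp
  ultimately have b: "V0 \<le> 2 * a\<^sup>2" "p * (V1 + V0) \<le> a\<^sup>2" using V_avg by (auto simp: algebra_simps)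
  have "subset_average p (I - {i}) (\<lambda>S. (\<integral>y. y \<partial>R (insert i S)) - (\<integral>y. y \<partial>R S)) \<le>
      subset_average p (I - {i}) (\<lambda>S. (K - 1) * (V S / (2 * a) + a / 2) + 2 * \<delta> * T + (V (insert i S) + V S) / (4 * T))"
  proof (rule subset_average_mono)
    fix S assume S: "S \<subseteq> I - {i}"
    then have "S \<subseteq> I" "insert i S \<subseteq> I" using i by auto
    then show "(\<integral>y. y \<partial>R (insert i S)) - (\<integral>y. y \<partial>R S) \<le>
        (K - 1) * (V S / (2 * a) + a / 2) + 2 * \<delta> * T + (V (insert i S) + V S) / (4 * T)"
      unfolding V_def using assms dp[OF i S] by (intro indistinguishable_mean_diff) auto
  qed (use p in auto)
  also have "\<dots> = (K - 1) * (V0 / (2 * a) + a / 2) + 2 * \<delta> * T + (V1 + V0) / (4 * T)"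
    unfolding V0_def V1_def by (simp add: subset_average_linear subset_average_const[OF fin])
  also have "\<dots> \<le> (K - 1) * (3 / 2 * a) + 2 * \<delta> * T + a\<^sup>2 / (4 * T * p)"
  proof (intro add_mono mult_left_mono order_refl)
    show "V0 / (2 * a) + a / 2 \<le> 3 / 2 * a" using b(1) \<open>a > 0\<close> by (simp add: field_simps power2_eq_square)
    show "(V1 + V0) / (4 * T) \<le> a\<^sup>2 / (4 * T * p)" 
    proof -
      have "V1 + V0 \<le> a\<^sup>2 / p" using b(2) p by (simp add: field_simps)
      then have "(V1 + V0) / (4 * T) \<le> a\<^sup>2 / p / (4 * T)" using \<open>T > 0\<close> by (intro divide_right_mono) auto
      then show ?thesis by (simp add: ac_simps)
    qed
  qed (use \<open>K \<ge> 1\<close> \<open>\<delta> \<ge> 0\<close> in auto)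
  finally show "subset_average p (I - {i}) (\<lambda>S. (\<integral>y. y \<partial>R (insert i S)) - (\<integral>y. y \<partial>R S)) \<le>
    (K - 1) * (3 / 2 * a) + 2 * \<delta> * T + a\<^sup>2 / (4 * T * p)" .
qed

lemma neighbouring_two_point_dataset:
  assumes "i < n" "i \<notin> S" "v \<noteq> 0"
  shows "neighbouring n (two_point_dataset {..<n} v (insert i S)) (two_point_dataset {..<n} v S)"
    and "neighbouring n (two_point_dataset {..<n} v S) (two_point_dataset {..<n} v (insert i S))"
proof -
  have "{j \<in> {..<n}. two_point_dataset {..<n} v (insert i S) j \<noteq> two_point_dataset {..<n} v S j} = {i}"
    using assms by (auto simp: two_point_dataset_def)
  then show "neighbouring n (two_point_dataset {..<n} v (insert i S)) (two_point_dataset {..<n} v S)"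
    "neighbouring n (two_point_dataset {..<n} v S) (two_point_dataset {..<n} v (insert i S))"
    unfolding neighbouring_def by (simp_all add: eq_commute[of "two_point_dataset {..<n} v S _"])
qed

text \<open>
  For samples in \<open>{0, 1 / \<gamma>}\<close>, the mean output \<open>G p\<close> stays
  close to the true mean \<open>p / \<gamma>\<close>, so on \<open>{p0..p1}\<close> it has a slope of at least \<open>1 / (2 * \<gamma>)\<close>
  somewhere. Privacy and the error bound limit the slope by a multiple of \<open>real n * sinh \<epsilon> * a\<close>. The
  interval stops at \<open>p0 = p1 / 2\<close> rather than at \<open>0\<close> because the second moment given a rare positive
  sample is only bounded by \<open>a\<^sup>2 / p\<close>.
\<close>

lemma two_point_accuracy_bound:
  fixes M :: "(nat \<Rightarrow> real) \<Rightarrow> real measure"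
  assumes eps: "\<epsilon> > 0" and "lam > 1" and g: "0 < \<gamma>" "\<gamma> \<le> 1" and "a > 0"
    and "0 \<le> \<delta>" "(lam - 1) * sqrt \<delta> / (2 * sinh \<epsilon>) \<le> \<gamma> powr lam"
    and M: "M \<in> randomized_algorithms n borel borel"
    and dp: "differentially_private \<epsilon> \<delta> n borel borel M"
    and int: "\<And>p. 0 < p \<Longrightarrow> p \<le> \<gamma> powr lam / 2 \<Longrightarrow> integrable (output_law n (two_point p (1 / \<gamma>)) M) (\<lambda>y. y)"
    and bias: "\<And>p. 0 < p \<Longrightarrow> p \<le> \<gamma> powr lam / 2 \<Longrightarrow>
      \<bar>(\<integral>y. y \<partial>output_law n (two_point p (1 / \<gamma>)) M) - p / \<gamma>\<bar> \<le> \<gamma> powr (lam - 1) / 16"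
    and mse: "\<And>p. 0 < p \<Longrightarrow> p \<le> \<gamma> powr lam / 2 \<Longrightarrow>
      (\<integral>\<^sup>+y. ennreal ((y - p / \<gamma>)\<^sup>2) \<partial>output_law n (two_point p (1 / \<gamma>)) M) \<le> ennreal (a\<^sup>2)"
  shows "1 \<le> 32 * real n * sinh \<epsilon> * (lam / (lam - 1)) * \<gamma> * a"
proof -
  define v where "v = 1 / \<gamma>"
  define p1 where "p1 = \<gamma> powr lam / 2"
  define p0 where "p0 = p1 / 2"
  define E where "E = 2 * sinh \<epsilon>"
  define t where "t = 1 / (lam - 1)"
  \<comment> \<open>The largest \<open>\<delta>\<close> that the hypothesis allows. It is positive, so that \<open>T\<close> below is well
    defined; this choice of \<open>T\<close> is \<open>a / sqrt d\<close>, for which both error terms caused by \<open>d\<close> are at most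
    of order \<open>a * E * t\<close>.\<close>
  define d where "d = (E * t * \<gamma> powr lam)\<^sup>2"
  define T where "T = a / (E * t * \<gamma> powr lam)"
  define R where "R = (\<lambda>S. M (two_point_dataset {..<n} v S))"
  define G where "G = (\<lambda>p. subset_average p {..<n} (\<lambda>S. \<integral>y. y \<partial>R S))"
  define G' where "G' = (\<lambda>p. \<Sum>i\<in>{..<n}. subset_average p ({..<n} - {i})
    (\<lambda>S. (\<integral>y. y \<partial>R (insert i S)) - (\<integral>y. y \<partial>R S)))"
  have E: "E > 0" using eps by (simp add: E_def)
  have t: "t > 0" using \<open>lam > 1\<close> by (simp add: t_def)
  have gl: "0 < \<gamma> powr lam" "\<gamma> powr lam \<le> 1" using g \<open>lam > 1\<close> by (auto intro: powr_le1)
  have p01: "0 < p0" "p0 < p1" "p1 \<le> 1 / 2" using gl by (auto simp: p0_def p1_def)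
  have T: "T > 0" using E t gl \<open>a > 0\<close> by (simp add: T_def)
  have d: "\<delta> \<le> d"
  proof -
    have "sqrt \<delta> \<le> E * t * \<gamma> powr lam"
      using assms(7) E \<open>lam > 1\<close> unfolding E_def[symmetric] t_def by (simp add: field_simps)
    then have "(sqrt \<delta>)\<^sup>2 \<le> d" unfolding d_def using \<open>0 \<le> \<delta>\<close> by (intro power_mono) auto
    then show ?thesis using \<open>0 \<le> \<delta>\<close> by simp
  qed
  have R: "prob_space (R S)" "sets (R S) = sets borel" for S
  proof -
    have "R S \<in> space (prob_algebra borel)"
      unfolding R_def using M unfolding randomized_algorithms_def product_power_def
      by (rule measurable_space) simp
    then show "prob_space (R S)" "sets (R S) = sets borel" by (auto simp: space_prob_algebra)
  qed
  have adj: "indistinguishable (exp \<epsilon>) d (R (insert i S)) (R S)" "indistinguishable (exp \<epsilon>) d (R S) (R (insert i S))"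
    if "i \<in> {..<n}" "S \<subseteq> {..<n} - {i}" for i S
  proof -
    have "v \<noteq> 0" using g by (simp add: v_def)
    then have nb: "neighbouring n (two_point_dataset {..<n} v (insert i S)) (two_point_dataset {..<n} v S)"
      "neighbouring n (two_point_dataset {..<n} v S) (two_point_dataset {..<n} v (insert i S))"
      using that neighbouring_two_point_dataset[of i n S v] by auto
    have "indistinguishable (exp \<epsilon>) d (M x) (M x')"
      if "neighbouring n x x'" "x \<in> space (product_power n borel)" "x' \<in> space (product_power n borel)"
        "sets (M x) = sets borel" for x x'
      using dp that d unfolding indistinguishable_def differentially_private_def
      by (smt (verit, best))
    then show "indistinguishable (exp \<epsilon>) d (R (insert i S)) (R S)" "indistinguishable (exp \<epsilon>) d (R S) (R (insert i S))"
      using nb R unfolding R_def product_power_def by simp_all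
  qed
  have measurable: "(\<lambda>y. y - c) \<in> borel_measurable (R S)" for c S
    unfolding measurable_cong_sets[OF R(2) refl] by simp
  have sq_measurable: "(\<lambda>y. (y - c)\<^sup>2) \<in> borel_measurable (R S)" for c S
    unfolding measurable_cong_sets[OF R(2) refl] by simp
  have sq: "integrable (R S) (\<lambda>y. (y - p * v)\<^sup>2)" (is ?sq)
    and avg: "subset_average p {..<n} (\<lambda>S. \<integral>y. (y - p * v)\<^sup>2 \<partial>R S) \<le> a\<^sup>2" (is ?avg)
    if p: "0 < p" "p \<le> p1" and S: "S \<subseteq> {..<n}" for p S
  proof -
    have p': "p < 1" using p p01 by simp
    have m: "(\<Sum>S\<in>Pow {..<n}. ennreal (subset_weight p {..<n} S) * (\<integral>\<^sup>+y. ennreal ((y - p * v)\<^sup>2) \<partial>R S)) \<le> ennreal (a\<^sup>2)"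
      using mse[of p] p nn_integral_output_law_two_point[OF M p(1) p', of "\<lambda>y. ennreal ((y - p * v)\<^sup>2)" v]
      unfolding R_def v_def p1_def by simp
    have sq: "integrable (R S) (\<lambda>y. (y - p * v)\<^sup>2)" if "S \<subseteq> {..<n}" for S
    proof (rule integrableI_nonneg)
      have "ennreal (subset_weight p {..<n} S) * (\<integral>\<^sup>+y. ennreal ((y - p * v)\<^sup>2) \<partial>R S) \<le>
        (\<Sum>S\<in>Pow {..<n}. ennreal (subset_weight p {..<n} S) * (\<integral>\<^sup>+y. ennreal ((y - p * v)\<^sup>2) \<partial>R S))"
        using that by (intro member_le_sum) auto
      also have "\<dots> < \<infinity>" using m by (rule order.strict_trans1) simp
      finally show "(\<integral>\<^sup>+y. ennreal ((y - p * v)\<^sup>2) \<partial>R S) < \<infinity>"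
        using subset_weight_pos[OF p(1) p', of "{..<n}" S] by (auto simp: ennreal_mult_less_top)
    qed (auto simp: sq_measurable)
    then show ?sq using S by blast
    have w: "0 \<le> subset_weight p {..<n} S" for S by (rule less_imp_le[OF subset_weight_pos[OF p(1) p']])
    have "ennreal (subset_average p {..<n} (\<lambda>S. \<integral>y. (y - p * v)\<^sup>2 \<partial>R S)) =
      (\<Sum>S\<in>Pow {..<n}. ennreal (subset_weight p {..<n} S * (\<integral>y. (y - p * v)\<^sup>2 \<partial>R S)))"
      unfolding subset_average_def using w by (intro sum_ennreal[symmetric]) (simp add: integral_nonneg_AE)
    also have "\<dots> = (\<Sum>S\<in>Pow {..<n}. ennreal (subset_weight p {..<n} S) * (\<integral>\<^sup>+y. ennreal ((y - p * v)\<^sup>2) \<partial>R S))"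
      using sq w by (intro sum.cong refl) (simp add: nn_integral_eq_integral ennreal_mult integral_nonneg_AE)
    finally have "ennreal (subset_average p {..<n} (\<lambda>S. \<integral>y. (y - p * v)\<^sup>2 \<partial>R S)) \<le> ennreal (a\<^sup>2)"
      using m by simp
    then show ?avg by (subst (asm) ennreal_le_iff) auto
  qed
  have iR: "integrable (R S) (\<lambda>y. y)" if "S \<subseteq> {..<n}" for S
  proof -
    interpret prob_space "R S" by (rule R)
    have "integrable (R S) (\<lambda>y. y - p1 * v)"
      by (rule square_integrable_imp_integrable[OF measurable sq]) (use p01 that in auto)
    from Bochner_Integration.integrable_add[OF this, of "\<lambda>_. p1 * v"] show ?thesis by simp
  qed
  have G: "(\<integral>y. y \<partial>output_law n (two_point p v) M) = G p" if "0 < p" "p \<le> p1" for p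
  proof -
    have p': "p < 1" using that p01 by simp
    have sets: "sets (output_law n (two_point p v) M) = sets borel"
      by (rule sets_output_law[OF M]) (auto simp: prob_space.not_empty[OF prob_space_two_point])
    show ?thesis unfolding G_def
    proof (rule integral_subset_average[OF that(1) p' _ _ iR])
      show "integrable (output_law n (two_point p v) M) (\<lambda>y. y)"
        using int that unfolding v_def p1_def by blast
      fix h :: "real \<Rightarrow> ennreal" assume "h \<in> borel_measurable (output_law n (two_point p v) M)"
      then have "h \<in> borel_measurable borel" by (simp add: measurable_cong_sets[OF sets refl])
      then show "(\<integral>\<^sup>+y. h y \<partial>output_law n (two_point p v) M) =
          (\<Sum>S\<in>Pow {..<n}. ennreal (subset_weight p {..<n} S) * (\<integral>\<^sup>+y. h y \<partial>R S))"
        unfolding R_def by (rule nn_integral_output_law_two_point[OF M that(1) p'])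
    qed auto
  qed
  have "\<exists>z. p0 < z \<and> z < p1 \<and> G p1 - G p0 = (p1 - p0) * G' z"
    unfolding G_def G'_def
    using p01(2) by (rule MVT2) (rule subset_average_has_derivative, simp)
  then obtain z where z: "p0 < z" "z < p1" "G p1 - G p0 = (p1 - p0) * G' z" by blast
  have upper: "G' z \<le> real n * (E * a * (3 / 2 + 3 * t))"
  proof -
    have "G' z \<le> real (card {..<n}) * ((exp \<epsilon> - 1) * (3 / 2 * a) + 2 * d * T + a\<^sup>2 / (4 * T * z))"
      unfolding G'_def
      by (rule indistinguishable_influence_bound[where c = "z * v"])
        (use R adj sq[of z] avg[of z "{}"] z p01 T \<open>a > 0\<close> eps in \<open>auto simp: d_def\<close>)
    also have "\<dots> \<le> real (card {..<n}) * (E * (3 / 2 * a) + 2 * (a * E * t) + a * E * t)"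
    proof (intro mult_left_mono add_mono)
      \<comment> \<open>Here \<open>exp \<epsilon> - 1 \<le> exp \<epsilon> - exp (- \<epsilon>) = 2 * sinh \<epsilon>\<close>.\<close>
      have "exp (-\<epsilon>) \<le> 1" using eps by simp
      then show "(exp \<epsilon> - 1) * (3 / 2 * a) \<le> E * (3 / 2 * a)"
        using \<open>a > 0\<close> unfolding E_def sinh_def by (intro mult_right_mono) auto
      have "d * T = a * E * t * \<gamma> powr lam"
        using E t gl unfolding d_def T_def by (simp add: power2_eq_square field_simps)
      also have "\<dots> \<le> a * E * t * 1" using E t gl \<open>a > 0\<close> by (intro mult_left_mono) auto
      finally show "2 * d * T \<le> 2 * (a * E * t)" by simp
      have "a\<^sup>2 / (4 * T * z) \<le> a\<^sup>2 / (4 * T * p0)"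
        using z p01 T by (intro divide_left_mono mult_left_mono) auto
      also have "\<dots> = a * E * t"
        using E t gl \<open>a > 0\<close> unfolding T_def p0_def p1_def by (simp add: power2_eq_square field_simps)
      finally show "a\<^sup>2 / (4 * T * z) \<le> a * E * t" .
    qed auto
    finally show ?thesis by (simp add: algebra_simps)
  qed
  have "v / 2 \<le> G' z"
  proof -
    \<comment> \<open>The means range up to \<open>p1 * v = \<gamma> powr (lam - 1) / 2\<close>, which is eight times the allowed bias.\<close>
    have gg: "\<gamma> powr (lam - 1) = 2 * p1 * v"
      using g by (simp add: powr_diff p1_def v_def)
    have "\<bar>G p1 - p1 * v\<bar> \<le> p1 * v / 8" "\<bar>G p0 - p0 * v\<bar> \<le> p1 * v / 8"
      using bias[of p1] bias[of p0] p01 G[of p1] G[of p0] gg unfolding p1_def[symmetric] v_def[symmetric]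
      by (simp_all add: v_def)
    moreover have "p0 * v = p1 * v / 2" by (simp add: p0_def)
    ultimately have "p1 * v / 4 \<le> (p1 - p0) * G' z" unfolding z(3)[symmetric] by linarith
    also have "(p1 - p0) * G' z = p1 * (G' z / 2)" by (simp add: p0_def)
    finally show ?thesis using p01 by (simp add: mult.commute)
  qed
  with upper have "v / 2 \<le> real n * (E * a * (3 / 2 + 3 * t))" by linarith
  also have "\<dots> \<le> real n * (E * a * (8 * (1 + t)))"
    using E t \<open>a > 0\<close> by (intro mult_left_mono) auto
  finally have "v / 2 * (2 * \<gamma>) \<le> real n * (E * a * (8 * (1 + t))) * (2 * \<gamma>)"
    using g by (intro mult_right_mono) auto
  moreover have "1 + t = lam / (lam - 1)" using \<open>lam > 1\<close> by (simp add: t_def field_simps)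
  ultimately show ?thesis using g by (simp add: v_def E_def algebra_simps)
qed

section \<open>The lower bound on the error\<close>

lemma two_point_satisfies_hypotheses:
  assumes "lam > 1" "0 < \<gamma>" "\<gamma> \<le> 1" "0 < p" "p \<le> \<gamma> powr lam / 2"
  shows "real_distribution (two_point p (1 / \<gamma>))" "integrable (two_point p (1 / \<gamma>)) (\<lambda>x. x)"
    "mean (two_point p (1 / \<gamma>)) = p / \<gamma>" "p / \<gamma> \<in> {0..1}"
    "(\<integral>\<^sup>+x. ennreal (\<bar>x - mean (two_point p (1 / \<gamma>))\<bar> powr lam) \<partial>two_point p (1 / \<gamma>)) \<le> 1"
proof -
  have le: "\<gamma> powr lam \<le> \<gamma>" using powr_mono'[of 1 lam \<gamma>] assms by simp
  then have p: "p \<le> 1 / 2" using assms by simp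
  show "real_distribution (two_point p (1 / \<gamma>))" "integrable (two_point p (1 / \<gamma>)) (\<lambda>x. x)"
    by (rule real_distribution_two_point integrable_two_point)+
  show "mean (two_point p (1 / \<gamma>)) = p / \<gamma>" using p assms by (simp add: mean_two_point)
  show "p / \<gamma> \<in> {0..1}" using le assms by (simp add: field_simps)
  have "2 * p * (1 / \<gamma>) powr lam \<le> \<gamma> powr lam * (1 / \<gamma>) powr lam"
    using assms by (intro mult_right_mono) auto
  also have "\<dots> = 1" using assms by (simp flip: powr_mult)
  finally show "(\<integral>\<^sup>+x. ennreal (\<bar>x - mean (two_point p (1 / \<gamma>))\<bar> powr lam) \<partial>two_point p (1 / \<gamma>)) \<le> 1"
    using p assms by (intro two_point_central_moment) auto
qed

text \<open>
  In the degenerate cases \<open>g0 = 0\<close> or \<open>\<alpha> = 0\<close> the assumption is contradictory: let \<open>g\<close>, respectively \<open>a\<close>,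
  tend to \<open>0\<close>. Admitting all larger positive values in the assumption thus covers at once the
  impossibility result that the extended-real inverse of \<open>0\<close> expresses.
\<close>

lemma inverse_le_of_scaled_products:
  fixes C g0 \<alpha> :: real
  assumes "C > 0" "0 \<le> g0" "g0 \<le> 1" "0 \<le> \<alpha>"
    and le: "\<And>g a. g0 \<le> g \<Longrightarrow> 0 < g \<Longrightarrow> g \<le> 1 \<Longrightarrow> \<alpha> \<le> a \<Longrightarrow> 0 < a \<Longrightarrow> 1 \<le> C * g * a"
  shows "inverse (ereal (C * g0)) \<le> ereal \<alpha>"
proof (cases "g0 = 0 \<or> \<alpha> = 0")
  case False
  then have "1 \<le> C * g0 * \<alpha>" using assms by (intro le) auto
  then have "inverse (C * g0) \<le> \<alpha>" using False assms by (simp add: field_simps)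
  then show ?thesis using False assms by simp
next
  case True
  have False
  proof (cases "g0 = 0")
    case True
    define a where "a = max \<alpha> 1"
    define g where "g = min 1 (1 / (2 * C * a))"
    have a: "a > 0" "\<alpha> \<le> a" by (auto simp: a_def)
    have g: "0 < g" "g \<le> 1" "g \<le> 1 / (2 * C * a)" using a \<open>C > 0\<close> by (auto simp: g_def)
    have "1 \<le> C * g * a" using True a g by (intro le) auto
    moreover have "C * g * a \<le> C * (1 / (2 * C * a)) * a"
      using a g \<open>C > 0\<close> by (intro mult_right_mono mult_left_mono) auto
    ultimately show False using a \<open>C > 0\<close> by simp
  next
    case nz: False
    then have "1 \<le> C * g0 * (1 / (2 * C * g0))" using True assms by (intro le) auto
    then show False using nz \<open>C > 0\<close> by simp
  qed
  then show ?thesis ..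
qed

theorem corollary2p3:
  fixes \<epsilon> \<delta> \<beta> \<alpha> lam :: real and n :: nat and M :: "(nat \<Rightarrow> real) \<Rightarrow> real measure"
  assumes "\<epsilon> > 0" and "\<delta> \<ge> 0" and "\<beta> \<ge> 0" and "\<alpha> \<ge> 0" and "lam > 1" and "n \<ge> 1"
    and "M \<in> randomized_algorithms n borel borel"
    and "differentially_private \<epsilon> \<delta> n borel borel M"
    and "\<And>P. \<lbrakk>real_distribution P; integrable P (\<lambda>x. x); mean P \<in> {0..1};
            (\<integral>\<^sup>+x. ennreal (\<bar>x - mean P\<bar> powr lam) \<partial>P) \<le> 1\<rbrakk>
          \<Longrightarrow> integrable (output_law n P M) (\<lambda>y. y) \<and>
              \<bar>(\<integral>y. y \<partial>output_law n P M) - mean P\<bar> \<le> \<beta> \<and>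
              (\<integral>\<^sup>+y. ennreal ((y - mean P)\<^sup>2) \<partial>output_law n P M) \<le> ennreal (\<alpha>\<^sup>2)"
    and "\<beta> \<le> 1 / 80"
    and "\<delta> \<le> (2 * sinh \<epsilon> / (5 powr (1 + 1 / (lam - 1)) * (lam - 1)))\<^sup>2"
  (* Inversion is in the extended reals, where the inverse of 0 is infinity: for beta = delta = 0 the
    conclusion is contradictory, so no such M exists. *)
  shows "ereal \<alpha> \<ge> inverse (ereal (32 * real n * sinh \<epsilon> * (lam / (lam - 1)) *
           max ((16 * \<beta>) powr (1 / (lam - 1)))
               (((lam - 1) * sqrt \<delta> / (2 * sinh \<epsilon>)) powr (1 / lam))))"
proof (rule inverse_le_of_scaled_products)
  let ?r = "(lam - 1) * sqrt \<delta> / (2 * sinh \<epsilon>)"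
  have r0: "0 \<le> ?r" using assms(1-5) by simp
  have r1: "?r \<le> 1"
  proof -
    let ?c = "5 powr (1 + 1 / (lam - 1))"
    have c: "?c \<ge> 1" using \<open>lam > 1\<close> by (intro ge_one_powr_ge_zero) auto
    have "sqrt \<delta> \<le> 2 * sinh \<epsilon> / (?c * (lam - 1))"
      by (rule real_le_lsqrt) (use assms in auto)
    also have "\<dots> \<le> 2 * sinh \<epsilon> / (1 * (lam - 1))"
      using c assms by (intro divide_left_mono mult_right_mono) auto
    finally show ?thesis using assms(1,5) by (simp add: field_simps)
  qed
  show "0 < 32 * real n * sinh \<epsilon> * (lam / (lam - 1))" using assms by simp
  show "0 \<le> max ((16 * \<beta>) powr (1 / (lam - 1))) (?r powr (1 / lam))" by (simp add: le_max_iff_disj)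
  show "max ((16 * \<beta>) powr (1 / (lam - 1))) (?r powr (1 / lam)) \<le> 1"
    using assms r0 r1 by (auto intro!: powr_le1)
  show "0 \<le> \<alpha>" by fact
  \<comment> \<open>For every \<open>\<gamma>\<close> above the maximum, the bias is at most \<open>\<gamma> powr (lam - 1) / 16\<close> and \<open>\<delta>\<close> is as small as
    \<open>two_point_accuracy_bound\<close> requires: the two terms of the maximum solve these conditions for \<open>\<gamma>\<close>.\<close>
  fix \<gamma> a
  assume g: "max ((16 * \<beta>) powr (1 / (lam - 1))) (?r powr (1 / lam)) \<le> \<gamma>" "0 < \<gamma>" "\<gamma> \<le> 1"
    and a: "\<alpha> \<le> a" "0 < a"
  have "((16 * \<beta>) powr (1 / (lam - 1))) powr (lam - 1) \<le> \<gamma> powr (lam - 1)"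
    using g \<open>lam > 1\<close> by (intro powr_mono2) auto
  then have \<beta>: "\<beta> \<le> \<gamma> powr (lam - 1) / 16" using assms(3,5) by (simp add: powr_powr)
  have "(?r powr (1 / lam)) powr lam \<le> \<gamma> powr lam"
    using g \<open>lam > 1\<close> by (intro powr_mono2) auto
  moreover have "(?r powr (1 / lam)) powr lam = ?r"
    unfolding powr_powr using \<open>lam > 1\<close> powr_one[OF r0] by simp
  ultimately have r: "?r \<le> \<gamma> powr lam" by simp
  have acc: "integrable (output_law n (two_point p (1 / \<gamma>)) M) (\<lambda>y. y) \<and>
      \<bar>(\<integral>y. y \<partial>output_law n (two_point p (1 / \<gamma>)) M) - p / \<gamma>\<bar> \<le> \<beta> \<and>
      (\<integral>\<^sup>+y. ennreal ((y - p / \<gamma>)\<^sup>2) \<partial>output_law n (two_point p (1 / \<gamma>)) M) \<le> ennreal (\<alpha>\<^sup>2)"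
    if "0 < p" "p \<le> \<gamma> powr lam / 2" for p
    using assms(9)[of "two_point p (1 / \<gamma>)"] two_point_satisfies_hypotheses[OF \<open>lam > 1\<close> g(2,3) that] by simp
  have a2: "ennreal (\<alpha>\<^sup>2) \<le> ennreal (a\<^sup>2)" using a \<open>\<alpha> \<ge> 0\<close> by (intro ennreal_leI power_mono)
  show "1 \<le> 32 * real n * sinh \<epsilon> * (lam / (lam - 1)) * \<gamma> * a"
  proof (rule two_point_accuracy_bound[OF assms(1,5) g(2,3) a(2) assms(2) r assms(7,8)])
    fix p assume "0 < p" "p \<le> \<gamma> powr lam / 2"
    note acc = acc[OF this]
    show "integrable (output_law n (two_point p (1 / \<gamma>)) M) (\<lambda>y. y)" using acc by blast
    show "\<bar>(\<integral>y. y \<partial>output_law n (two_point p (1 / \<gamma>)) M) - p / \<gamma>\<bar> \<le> \<gamma> powr (lam - 1) / 16"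
      using acc \<beta> by linarith
    show "(\<integral>\<^sup>+y. ennreal ((y - p / \<gamma>)\<^sup>2) \<partial>output_law n (two_point p (1 / \<gamma>)) M) \<le> ennreal (a\<^sup>2)"
      using acc a2 by (blast intro: order.trans)
  qed
qed

end
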